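(* Let $R$ be a ring and let $e\in R$ be an idempotent. If $R$ is a strongly $\Delta$-clean ring, then so is the corner ring $eRe$.
   Context: Rings are associative with identity, not necessarily commutative; $eRe$ is a ring with identity $e$. For a ring $S$, $U(S)$ is the group of units and $\Delta(S)=\{x\in S \mid 1-xu\in U(S)\text{ for all }u\in U(S)\}$. A ring $S$ is strongly $\Delta$-clean if every $a\in S$ can be written $a=f+d$ with $f^2=f\in S$, $d\in\Delta(S)$ and $fd=df$. *)

theory Defs
  imports "HOL-Algebra.Ring"
begin

definition Delta :: "('a, 'm) ring_scheme \<Rightarrow> 'a set" where
  "Delta S = {x \<in> carrier S. \<forall>u \<in> Units S. \<one>\<^bsub>S\<^esub> \<ominus>\<^bsub>S\<^esub> x \<otimes>\<^bsub>S\<^esub> u \<in> Units S}"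

definition strongly_Delta_clean :: "('a, 'm) ring_scheme \<Rightarrow> bool" where
  "strongly_Delta_clean S \<longleftrightarrow> ring S \<and>
     (\<forall>a \<in> carrier S. \<exists>f \<in> carrier S. \<exists>d \<in> Delta S.
        f \<otimes>\<^bsub>S\<^esub> f = f \<and> a = f \<oplus>\<^bsub>S\<^esub> d \<and> f \<otimes>\<^bsub>S\<^esub> d = d \<otimes>\<^bsub>S\<^esub> f)"

definition corner_ring :: "('a, 'm) ring_scheme \<Rightarrow> 'a \<Rightarrow> ('a, 'm) ring_scheme" where
  "corner_ring R e =
     R\<lparr>carrier := {e \<otimes>\<^bsub>R\<^esub> x \<otimes>\<^bsub>R\<^esub> e | x. x \<in> carrier R}, one := e\<rparr>"

text \<open>Units, zero and subtraction of the corner are computed in the corner itself: its units are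
  the elements invertible with respect to \<open>e\<close>. For \<open>e\<close> equal to zero it is the zero ring.\<close>

lemma ring_corner_ring:
  fixes R (structure)
  assumes "ring R" and e: "e \<in> carrier R" "e \<otimes> e = e"
  shows "ring (corner_ring R e)"
proof -
  interpret ring R by fact
  have ee: "e \<otimes> (e \<otimes> x) = e \<otimes> x" if "x \<in> carrier R" for x
    using that e by (metis m_assoc)
  have add: "e \<otimes> x \<otimes> e \<oplus> e \<otimes> y \<otimes> e = e \<otimes> (x \<oplus> y) \<otimes> e"
    if "x \<in> carrier R" "y \<in> carrier R" for x y
    using that e by (simp add: l_distr r_distr)
  have mult: "(e \<otimes> x \<otimes> e) \<otimes> (e \<otimes> y \<otimes> e) = e \<otimes> (x \<otimes> e \<otimes> y) \<otimes> e"
    if "x \<in> carrier R" "y \<in> carrier R" for x y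
    using that e by (simp add: m_assoc ee)
  have zero: "\<zero> = e \<otimes> \<zero> \<otimes> e" using e by simp
  have one: "e = e \<otimes> \<one> \<otimes> e" using e by simp
  have neg: "e \<otimes> (\<ominus> x) \<otimes> e \<oplus> e \<otimes> x \<otimes> e = \<zero>" if "x \<in> carrier R" for x
    using that e by (simp add: add l_neg)
  show ?thesis
  proof (rule ringI)
    show "abelian_group (corner_ring R e)"
    proof (rule abelian_groupI)
      fix x y assume "x \<in> carrier (corner_ring R e)" "y \<in> carrier (corner_ring R e)"
      then show "x \<oplus>\<^bsub>corner_ring R e\<^esub> y \<in> carrier (corner_ring R e)"
        using e unfolding corner_ring_def by (auto simp: add)
    next
      show "\<zero>\<^bsub>corner_ring R e\<^esub> \<in> carrier (corner_ring R e)"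
        unfolding corner_ring_def using zero by auto
    next
      fix x assume "x \<in> carrier (corner_ring R e)"
      then obtain z where z: "z \<in> carrier R" "x = e \<otimes> z \<otimes> e"
        by (auto simp: corner_ring_def)
      show "\<exists>y\<in>carrier (corner_ring R e). y \<oplus>\<^bsub>corner_ring R e\<^esub> x = \<zero>\<^bsub>corner_ring R e\<^esub>"
      proof (rule bexI)
        show "e \<otimes> (\<ominus> z) \<otimes> e \<oplus>\<^bsub>corner_ring R e\<^esub> x = \<zero>\<^bsub>corner_ring R e\<^esub>"
          using neg[OF z(1)] z(2) by (simp add: corner_ring_def)
        show "e \<otimes> (\<ominus> z) \<otimes> e \<in> carrier (corner_ring R e)"
          using z(1) a_inv_closed unfolding corner_ring_def by auto
      qed
    qed (use e in \<open>auto simp: corner_ring_def a_ac\<close>)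
    show "Group.monoid (corner_ring R e)"
    proof (rule monoidI)
      fix x y assume "x \<in> carrier (corner_ring R e)" "y \<in> carrier (corner_ring R e)"
      then show "x \<otimes>\<^bsub>corner_ring R e\<^esub> y \<in> carrier (corner_ring R e)"
        using e unfolding corner_ring_def by (auto simp: mult)
    next
      show "\<one>\<^bsub>corner_ring R e\<^esub> \<in> carrier (corner_ring R e)"
        unfolding corner_ring_def using one by auto
    qed (use e in \<open>auto simp: corner_ring_def m_assoc ee\<close>)
  qed (use e in \<open>auto simp: corner_ring_def l_distr r_distr\<close>)
qed

end

theory Submission
  imports Defs
begin

text \<open>Write \<open>a \<in> eRe\<close> as \<open>a = f + d\<close> in \<open>R\<close>. Since \<open>f a = a f = f (1 + d)\<close> with \<open>1 + d\<close> a unit,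
  whatever annihilates \<open>a\<close> annihilates \<open>f\<close>; applied to \<open>1 - e\<close> on either side this gives
  \<open>f \<in> eRe\<close>, hence also \<open>d \<in> eRe\<close>. Finally \<open>\<Delta>(R) \<inter> eRe \<subseteq> \<Delta>(eRe)\<close>, because \<open>u + (1 - e)\<close> is a
  unit of \<open>R\<close> for every unit \<open>u\<close> of \<open>eRe\<close>.\<close>

lemma corner_ring_simps [simp]:
  "x \<otimes>\<^bsub>corner_ring R e\<^esub> y = x \<otimes>\<^bsub>R\<^esub> y"
  "x \<oplus>\<^bsub>corner_ring R e\<^esub> y = x \<oplus>\<^bsub>R\<^esub> y"
  "\<one>\<^bsub>corner_ring R e\<^esub> = e"
  "\<zero>\<^bsub>corner_ring R e\<^esub> = \<zero>\<^bsub>R\<^esub>"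
  by (simp_all add: corner_ring_def)

text \<open>Trades the existential form of the carrier for fixed-point equations, on which later
  membership proofs rest.\<close>

lemma (in ring) carrier_corner_ring_iff:
  assumes "e \<in> carrier R" "e \<otimes> e = e"
  shows "x \<in> carrier (corner_ring R e) \<longleftrightarrow> x \<in> carrier R \<and> e \<otimes> x = x \<and> x \<otimes> e = x"
proof
  assume "x \<in> carrier (corner_ring R e)"
  then obtain y where y: "y \<in> carrier R" "x = e \<otimes> y \<otimes> e"
    by (auto simp: corner_ring_def)
  have "e \<otimes> x = (e \<otimes> e) \<otimes> y \<otimes> e"
    using y assms(1) by (simp add: m_assoc)
  moreover have "x \<otimes> e = e \<otimes> y \<otimes> (e \<otimes> e)"
    using y assms(1) by (simp add: m_assoc)
  ultimately show "x \<in> carrier R \<and> e \<otimes> x = x \<and> x \<otimes> e = x"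
    using y assms by simp
next
  assume "x \<in> carrier R \<and> e \<otimes> x = x \<and> x \<otimes> e = x"
  then show "x \<in> carrier (corner_ring R e)"
    unfolding corner_ring_def by (auto intro!: exI[of _ x])
qed

text \<open>The negative in the corner is a description ranging over the smaller carrier, so it does
  not simply unfold to that of \<open>R\<close>. As \<open>\<ominus> y\<close> lies in the corner,
  uniqueness of additive inverses identifies the two.\<close>

lemma (in ring) a_minus_corner_ring:
  assumes "e \<in> carrier R" "e \<otimes> e = e"
    and "x \<in> carrier (corner_ring R e)" "y \<in> carrier (corner_ring R e)"
  shows "x \<ominus>\<^bsub>corner_ring R e\<^esub> y = x \<ominus> y"
proof -
  interpret C: ring "corner_ring R e"
    by (rule ring_corner_ring) (use assms in \<open>simp_all add: ring_axioms\<close>)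
  have y: "y \<in> carrier R" "e \<otimes> y = y" "y \<otimes> e = y"
    using assms carrier_corner_ring_iff by auto
  have "\<ominus> y \<in> carrier (corner_ring R e)"
    using y assms(1,2) by (simp add: carrier_corner_ring_iff r_minus l_minus)
  then have "\<ominus>\<^bsub>corner_ring R e\<^esub> y = \<ominus> y"
    using assms(4) y by (intro C.minus_equality) (simp_all add: l_neg)
  then show ?thesis by (simp add: a_minus_def)
qed

text \<open>If \<open>v\<close> inverts \<open>u\<close> in the corner, then
  \<open>v \<oplus> (\<one> \<ominus> e)\<close> inverts the sum: the mixed products vanish, and
  what remains is \<open>e \<oplus> (\<one> \<ominus> e) = \<one>\<close>.\<close>

lemma (in ring) add_compl_idempotent_Units:
  assumes e: "e \<in> carrier R" "e \<otimes> e = e" and u: "u \<in> Units (corner_ring R e)"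
  shows "u \<oplus> (\<one> \<ominus> e) \<in> Units R"
proof -
  obtain v where uv: "u \<otimes> v = e" "v \<otimes> u = e"
    and "v \<in> carrier (corner_ring R e)" "u \<in> carrier (corner_ring R e)"
    using u by (auto simp: Units_def)
  then have c: "u \<in> carrier R" "e \<otimes> u = u" "u \<otimes> e = u" "v \<in> carrier R" "e \<otimes> v = v" "v \<otimes> e = v"
    using e carrier_corner_ring_iff by auto
  define g where "g = \<one> \<ominus> e"
  have g: "g \<in> carrier R" "e \<oplus> g = \<one>"
    using e by (simp_all add: g_def a_minus_def a_lcomm[of e \<one>] r_neg)
  have gg: "g \<otimes> g = g" "u \<otimes> g = \<zero>" "g \<otimes> u = \<zero>" "v \<otimes> g = \<zero>" "g \<otimes> v = \<zero>"
    using c e by (simp_all add: g_def a_minus_def l_distr r_distr l_minus r_minus r_neg l_neg)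
  have "(u \<oplus> g) \<otimes> (v \<oplus> g) = \<one>" "(v \<oplus> g) \<otimes> (u \<oplus> g) = \<one>"
    using c e g gg uv by (simp_all add: l_distr r_distr)
  then show ?thesis
    using c g unfolding g_def[symmetric] Units_def by (auto intro!: bexI[of _ "v \<oplus> g"])
qed

text \<open>The unit \<open>\<one> \<ominus> x\<close> commutes with \<open>e\<close>, both products
  being \<open>e \<ominus> x\<close>. Hence if \<open>y\<close> is its inverse in \<open>R\<close>,
  the compression \<open>e \<otimes> y \<otimes> e\<close> inverts \<open>e \<ominus> x\<close> in
  the corner.\<close>

lemma (in ring) Units_corner_ringI:
  assumes e: "e \<in> carrier R" "e \<otimes> e = e"
    and x: "x \<in> carrier (corner_ring R e)" and unit: "\<one> \<ominus> x \<in> Units R"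
  shows "e \<ominus> x \<in> Units (corner_ring R e)"
proof -
  have xR: "x \<in> carrier R" "e \<otimes> x = x" "x \<otimes> e = x"
    using x e carrier_corner_ring_iff by auto
  obtain y where y: "y \<in> carrier R" "y \<otimes> (\<one> \<ominus> x) = \<one>" "(\<one> \<ominus> x) \<otimes> y = \<one>"
    using unit by (auto simp: Units_def)
  have left: "e \<otimes> (\<one> \<ominus> x) = e \<ominus> x" and right: "(\<one> \<ominus> x) \<otimes> e = e \<ominus> x"
    and eleft: "e \<otimes> (e \<ominus> x) = e \<ominus> x" and eright: "(e \<ominus> x) \<otimes> e = e \<ominus> x"
    using xR e by (simp_all add: a_minus_def l_distr r_distr l_minus r_minus)
  have cl: "e \<ominus> x \<in> carrier R" "\<one> \<ominus> x \<in> carrier R" using xR e by auto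
  have "(e \<otimes> y \<otimes> e) \<otimes> (e \<ominus> x) = e \<otimes> y \<otimes> (e \<otimes> (e \<ominus> x))"
    using y e cl by (simp add: m_assoc)
  also have "\<dots> = e \<otimes> y \<otimes> ((\<one> \<ominus> x) \<otimes> e)"
    by (simp only: eleft right)
  also have "\<dots> = e \<otimes> (y \<otimes> (\<one> \<ominus> x)) \<otimes> e"
    using y(1) e(1) cl by (simp add: m_assoc)
  finally have 1: "(e \<otimes> y \<otimes> e) \<otimes> (e \<ominus> x) = e" using y e by simp
  have "(e \<ominus> x) \<otimes> (e \<otimes> y \<otimes> e) = ((e \<ominus> x) \<otimes> e) \<otimes> y \<otimes> e"
    using y e cl by (simp add: m_assoc)
  also have "\<dots> = (e \<otimes> (\<one> \<ominus> x)) \<otimes> y \<otimes> e"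
    by (simp only: eright left)
  also have "\<dots> = e \<otimes> ((\<one> \<ominus> x) \<otimes> y) \<otimes> e"
    using y e cl by (simp add: m_assoc)
  finally have 2: "(e \<ominus> x) \<otimes> (e \<otimes> y \<otimes> e) = e" using y e by simp
  have "e \<otimes> y \<otimes> e \<in> carrier (corner_ring R e)"
    using y(1) by (auto simp: corner_ring_def)
  moreover have "e \<ominus> x \<in> carrier (corner_ring R e)"
    using e cl eleft eright by (simp add: carrier_corner_ring_iff)
  ultimately show ?thesis
    using 1 2 by (auto simp: Units_def)
qed

lemma (in ring) Delta_corner_ringI:
  assumes e: "e \<in> carrier R" "e \<otimes> e = e"
    and x: "x \<in> carrier (corner_ring R e)" "x \<in> Delta R"
  shows "x \<in> Delta (corner_ring R e)"
  unfolding Delta_def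
proof (intro CollectI conjI ballI x(1))
  fix u assume u: "u \<in> Units (corner_ring R e)"
  interpret C: ring "corner_ring R e"
    by (rule ring_corner_ring) (use e in \<open>simp_all add: ring_axioms\<close>)
  have uC: "u \<in> carrier (corner_ring R e)" using u by (rule C.Units_closed)
  have xu: "x \<otimes> u \<in> carrier (corner_ring R e)" using C.m_closed[OF x(1) uC] by simp
  have c: "x \<in> carrier R" "x \<otimes> e = x" "u \<in> carrier R"
    using x(1) uC e carrier_corner_ring_iff by auto
  \<comment> \<open>As \<open>x = x \<otimes> e\<close>, the summand
    \<open>\<one> \<ominus> e\<close> is annihilated, so testing \<open>x\<close> against the lifted
    unit of \<open>R\<close> amounts to testing it against \<open>u\<close>.\<close>
  have "x \<otimes> (u \<oplus> (\<one> \<ominus> e)) = x \<otimes> u"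
    using c e by (simp add: a_minus_def r_distr r_minus r_neg)
  moreover have "\<one> \<ominus> x \<otimes> (u \<oplus> (\<one> \<ominus> e)) \<in> Units R"
    using x(2) add_compl_idempotent_Units[OF e u] by (auto simp: Delta_def)
  ultimately have "e \<ominus> x \<otimes> u \<in> Units (corner_ring R e)"
    using Units_corner_ringI[OF e xu] by simp
  moreover have "e \<ominus>\<^bsub>corner_ring R e\<^esub> x \<otimes> u = e \<ominus> x \<otimes> u"
    using a_minus_corner_ring[OF e _ xu] C.one_closed by simp
  ultimately show "\<one>\<^bsub>corner_ring R e\<^esub> \<ominus>\<^bsub>corner_ring R e\<^esub> x \<otimes>\<^bsub>corner_ring R e\<^esub> u \<in> Units (corner_ring R e)"
    by simp
qed

text \<open>This is the defining condition of \<open>Delta R\<close> at the unit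
  \<open>\<ominus> \<one>\<close>, which is its own inverse.\<close>

lemma (in ring) one_add_Delta_Units:
  assumes "d \<in> Delta R"
  shows "\<one> \<oplus> d \<in> Units R"
proof -
  have "\<ominus> \<one> \<in> Units R"
    by (auto simp: Units_def l_minus r_minus intro!: bexI[of _ "\<ominus> \<one>"])
  then have "\<one> \<ominus> d \<otimes> (\<ominus> \<one>) \<in> Units R" "d \<in> carrier R"
    using assms by (auto simp: Delta_def)
  then show ?thesis by (simp add: a_minus_def r_minus)
qed

lemma (in ring) mult_Units_cancel_right:
  assumes "w \<in> Units R" "x \<in> carrier R" "y \<in> carrier R" "x \<otimes> w = y \<otimes> w"
  shows "x = y"
proof -
  have "x \<otimes> w \<otimes> inv w = y \<otimes> w \<otimes> inv w" using assms(4) by simp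
  then show ?thesis using assms(1-3) by (simp add: m_assoc Units_closed)
qed

lemma (in ring) idempotent_part_in_corner_ring:
  assumes e: "e \<in> carrier R" "e \<otimes> e = e"
    and a: "f \<oplus> d \<in> carrier (corner_ring R e)"
    and f: "f \<in> carrier R" "f \<otimes> f = f" and d: "d \<in> Delta R" and comm: "f \<otimes> d = d \<otimes> f"
  shows "f \<in> carrier (corner_ring R e)"
proof -
  define a where "a = f \<oplus> d"
  define w where "w = \<one> \<oplus> d"
  have dR: "d \<in> carrier R" using d by (simp add: Delta_def)
  have aR: "a \<in> carrier R" "e \<otimes> a = a" "a \<otimes> e = a"
    using a e carrier_corner_ring_iff unfolding a_def by auto
  have w: "w \<in> Units R" unfolding w_def by (rule one_add_Delta_Units[OF d])
  have wR: "w \<in> carrier R" using w by (rule Units_closed)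
  \<comment> \<open>Idempotence lets \<open>f\<close> absorb the difference between
    \<open>\<one>\<close> and \<open>f\<close>: both \<open>f \<otimes> w\<close> and
    \<open>f \<otimes> a\<close> equal \<open>f \<oplus> f \<otimes> d\<close>. The other two
    equations use that \<open>f\<close> and \<open>d\<close> commute.\<close>
  have fw: "f \<otimes> w = f \<otimes> a" "f \<otimes> w = a \<otimes> f" "w \<otimes> f = f \<otimes> w"
    using f dR comm by (simp_all add: w_def a_def l_distr r_distr)
  \<comment> \<open>Writing \<open>f \<otimes> w\<close> as \<open>a \<otimes> f\<close> puts
    \<open>a\<close> next to \<open>e\<close>, which it absorbs; the unit \<open>w\<close> is then
    cancelled on the right.\<close>
  have "e \<otimes> f \<otimes> w = f \<otimes> w"
  proof -
    have "e \<otimes> f \<otimes> w = e \<otimes> a \<otimes> f" using e f aR(1) wR fw(2) by (simp add: m_assoc)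
    then show ?thesis using aR fw(2) by simp
  qed
  then have 1: "e \<otimes> f = f"
    using mult_Units_cancel_right[OF w] e f by simp
  \<comment> \<open>Here \<open>e\<close> sits on the right, so \<open>w\<close> is carried past
    \<open>f\<close> to be cancelled on the left, and \<open>f \<otimes> w\<close> is read as
    \<open>f \<otimes> a\<close>.\<close>
  have "w \<otimes> (f \<otimes> e) = w \<otimes> f"
  proof -
    have "w \<otimes> (f \<otimes> e) = f \<otimes> w \<otimes> e"
      using e f wR fw(3) by (metis m_assoc)
    also have "\<dots> = f \<otimes> (a \<otimes> e)" using e f aR(1) fw(1) by (simp add: m_assoc)
    also have "\<dots> = w \<otimes> f" using aR fw by simp
    finally show ?thesis .
  qed
  then have 2: "f \<otimes> e = f"
    using Units_l_cancel[OF w] e f by simp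
  show ?thesis using 1 2 e f by (simp add: carrier_corner_ring_iff)
qed

theorem corollary2p20:
  fixes R :: "('a, 'm) ring_scheme" (structure) and e :: 'a
  assumes "ring R"
    and "e \<in> carrier R"
    and "e \<otimes> e = e"
    and "strongly_Delta_clean R"
  shows "strongly_Delta_clean (corner_ring R e)"
proof -
  interpret ring R by fact
  note e = assms(2,3)
  interpret C: ring "corner_ring R e"
    by (rule ring_corner_ring) (use assms in simp_all)
  have "\<exists>f\<in>carrier (corner_ring R e). \<exists>d\<in>Delta (corner_ring R e).
      f \<otimes> f = f \<and> a = f \<oplus> d \<and> f \<otimes> d = d \<otimes> f"
    if a: "a \<in> carrier (corner_ring R e)" for a
  proof -
    have aR: "a \<in> carrier R" using a e by (simp add: carrier_corner_ring_iff)
    then obtain f d where fd: "f \<in> carrier R" "d \<in> Delta R" "f \<otimes> f = f" "a = f \<oplus> d"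
      "f \<otimes> d = d \<otimes> f"
      using assms(4) unfolding strongly_Delta_clean_def by blast
    have fC: "f \<in> carrier (corner_ring R e)"
      using idempotent_part_in_corner_ring[OF e _ fd(1,3,2,5)] a fd(4) by simp
    have dR: "d \<in> carrier R" using fd(2) by (simp add: Delta_def)
    \<comment> \<open>As a difference of two corner elements, \<open>d\<close> inherits membership
      from closure under subtraction.\<close>
    have "d = a \<ominus> f"
      using fd(1,4) dR by (simp add: a_minus_def a_comm[of f] a_assoc r_neg)
    then have "d \<in> carrier (corner_ring R e)"
      using a_minus_corner_ring[OF e a fC] C.minus_closed[OF a fC] by simp
    then have "d \<in> Delta (corner_ring R e)"
      using Delta_corner_ringI[OF e] fd(2) by simp
    then show ?thesis using fC fd by blast
  qed
  then show ?thesis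
    unfolding strongly_Delta_clean_def using C.ring_axioms by simp
qed

end
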